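(* Let $P$ be an admissible distribution on $[0,1]^n$ and let $q\in[-\infty,1]$. Under the Hölder-mean welfare $w_q$, the regret of any fluid policy $\mathsf{F}$ satisfies $$\mathcal{R}_T(\mathsf{F})=\mathbb{E}\left[\mathsf{OPT}-\mathsf{ALG}(\mathsf{F})\right]=O(\sqrt{T})\quad\text{as }T\to\infty.$$
   Context: There are $n$ agents and $T$ periods. $\Delta_n=\{x\in\mathbb{R}_+^n:\sum_i x^i=1\}$. A distribution $P$ on $[0,1]^n$ is admissible if it has finite support: $P\{b=\beta_\ell\}=p_\ell>0$ for $\ell\in[L]=\{1,\dots,L\}$, with distinct $\beta_\ell\in[0,1]^n$ and $\sum_\ell p_\ell=1$. The marginal utility vectors $b_1,\dots,b_T$ are i.i.d. with law $P$; $N_\ell=\sum_{t=1}^T\mathbf{1}\{b_t=\beta_\ell\}$. Allocations $x_1,\dots,x_T\in\Delta_n$ give agent $i$ the cumulative utility $B_T^i=\sum_{t=1}^T b_t^i x_t^i$. Hölder means on $\mathbb{R}_+^n$: $w_{-\infty}(B)=\min_i B^i$; for $q\in(-\infty,0)$, $w_q(B)=\left(\frac1n\sum_i (B^i)^q\right)^{1/q}$ if all $B^i>0$ and $w_q(B)=0$ otherwise; $w_0(B)=\left(\prod_i B^i\right)^{1/n}$; for $q\in(0,1]$, $w_q(B)=\left(\frac1n\sum_i (B^i)^q\right)^{1/q}$. Hindsight optimum: $\mathsf{OPT}=\max\left\{w_q\left(\left(\sum_{t=1}^T b_t^i x_t^i\right)_{i}\right): x_1,\dots,x_T\in\Delta_n\right\}$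 for the realized sequence. A static policy $\boldsymbol\xi=(\xi_\ell)_{\ell\in[L]}\in\Delta_n^L$ allocates $x_t=\xi_\ell$ whenever $b_t=\beta_\ell$, so $B_T^i=\sum_\ell N_\ell\beta_\ell^i\xi_\ell^i$, and $\mathsf{ALG}(\boldsymbol\xi)=w_q(B_T)$. A fluid policy $\mathsf{F}$ is a static policy that is an optimal solution of $\max\left\{w_q\left(\left(T\sum_{\ell}p_\ell\beta_\ell^i\xi_\ell^i\right)_{i}\right):\boldsymbol\xi\in\Delta_n^L\right\}$ (the set of optimal solutions does not depend on $T$ by homogeneity). *)

theory Defs
  imports "HOL-Probability.Probability" "HOL-Library.Landau_Symbols"
begin

definition std_simplex :: "(real ^ 'n) set" where
  "std_simplex = {x. (\<forall>i. 0 \<le> x $ i) \<and> (\<Sum>i\<in>UNIV. x $ i) = 1}"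

text \<open>
  The values \<open>\<beta>\<^sub>l\<close> are the elements of the support and \<open>p\<^sub>l\<close> is \<open>pmf P \<beta>\<^sub>l\<close>; positivity of the
  \<open>p\<^sub>l\<close>, distinctness of the \<open>\<beta>\<^sub>l\<close> and total mass 1 are then automatic.
\<close>
definition admissible :: "(real ^ 'n) pmf \<Rightarrow> bool" where
  "admissible P \<longleftrightarrow> finite (set_pmf P) \<and> (\<forall>\<beta>\<in>set_pmf P. \<forall>i. \<beta> $ i \<in> {0..1})"

text \<open>Only meant for vectors with nonnegative entries and for exponents \<open>q \<le> 1\<close>.\<close>
definition holder_mean :: "ereal \<Rightarrow> real ^ 'n \<Rightarrow> real" where
  "holder_mean q B =
    (if q = -\<infinity> then Min (range (\<lambda>i. B $ i))
     else if q = 0 then root CARD('n) (\<Prod>i\<in>UNIV. B $ i)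
     else if q < 0 \<and> \<not> (\<forall>i. B $ i > 0) then 0
     else ((1 / real CARD('n)) * (\<Sum>i\<in>UNIV. (B $ i) powr real_of_ereal q))
            powr (1 / real_of_ereal q))"

definition cumulative_utility ::
    "nat \<Rightarrow> (nat \<Rightarrow> real ^ 'n) \<Rightarrow> (nat \<Rightarrow> real ^ 'n) \<Rightarrow> real ^ 'n" where
  "cumulative_utility T b x = (\<chi> i. \<Sum>t = 1..T. b t $ i * x t $ i)"

text \<open>For nonnegative \<open>b\<close> the supremum is a maximum, by compactness of the simplex.\<close>
definition opt :: "ereal \<Rightarrow> nat \<Rightarrow> (nat \<Rightarrow> real ^ 'n) \<Rightarrow> real" where
  "opt q T b = (SUP x \<in> {1..T} \<rightarrow> std_simplex. holder_mean q (cumulative_utility T b x))"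

text \<open>
  A static policy is indexed by the support points themselves; its values outside the support
  are irrelevant.
\<close>
definition static_policy :: "(real ^ 'n) pmf \<Rightarrow> (real ^ 'n \<Rightarrow> real ^ 'n) \<Rightarrow> bool" where
  "static_policy P \<xi> \<longleftrightarrow> (\<forall>\<beta>\<in>set_pmf P. \<xi> \<beta> \<in> std_simplex)"

definition alg ::
    "ereal \<Rightarrow> nat \<Rightarrow> (real ^ 'n \<Rightarrow> real ^ 'n) \<Rightarrow> (nat \<Rightarrow> real ^ 'n) \<Rightarrow> real" where
  "alg q T \<xi> b = holder_mean q (cumulative_utility T b (\<lambda>t. \<xi> (b t)))"

definition fluid_utility ::
    "(real ^ 'n) pmf \<Rightarrow> nat \<Rightarrow> (real ^ 'n \<Rightarrow> real ^ 'n) \<Rightarrow> real ^ 'n" where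
  "fluid_utility P T \<xi> = (\<chi> i. real T * (\<Sum>\<beta>\<in>set_pmf P. pmf P \<beta> * \<beta> $ i * \<xi> \<beta> $ i))"

definition fluid_policy ::
    "ereal \<Rightarrow> (real ^ 'n) pmf \<Rightarrow> nat \<Rightarrow> (real ^ 'n \<Rightarrow> real ^ 'n) \<Rightarrow> bool" where
  "fluid_policy q P T \<xi> \<longleftrightarrow> static_policy P \<xi> \<and>
    (\<forall>\<xi>'. static_policy P \<xi>' \<longrightarrow>
       holder_mean q (fluid_utility P T \<xi>') \<le> holder_mean q (fluid_utility P T \<xi>))"

text \<open>
  The product distribution on the index set \<open>{1..T}\<close> is the joint law of \<open>T\<close> i.i.d. draws from
  \<open>P\<close>. For admissible \<open>P\<close> it has finite support, so every integrand is integrable.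
\<close>
definition regret ::
    "ereal \<Rightarrow> (real ^ 'n) pmf \<Rightarrow> nat \<Rightarrow> (real ^ 'n \<Rightarrow> real ^ 'n) \<Rightarrow> real" where
  "regret q P T \<xi> =
    measure_pmf.expectation (Pi_pmf {1..T} 0 (\<lambda>_. P)) (\<lambda>b. opt q T b - alg q T \<xi> b)"

lemma holder_mean_scale:
  fixes B :: "real ^ 'n"
  assumes c: "c > 0" and B: "\<And>i. 0 \<le> B $ i" and q: "q \<le> 1"
  shows "holder_mean q (\<chi> i. c * B $ i) = c * holder_mean q B"
proof -
  consider "q = -\<infinity>" | "q = 0" | r where "q = ereal r" "r \<noteq> 0"
    using q by (cases q) (auto simp: zero_ereal_def)
  then show ?thesis
  proof cases
    case 1
    have "mono ((*) c)" using c by (auto intro!: monoI mult_left_mono)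
    then have "c * Min (range (\<lambda>i. B $ i)) = Min ((*) c ` range (\<lambda>i. B $ i))"
      by (intro mono_Min_commute) auto
    also have "(*) c ` range (\<lambda>i. B $ i) = range (\<lambda>i. c * B $ i)" by auto
    finally show ?thesis using 1 by (simp add: holder_mean_def)
  next
    case 2
    then show ?thesis using c
      by (simp add: holder_mean_def prod.distrib real_root_mult real_root_power_cancel)
  next
    case 3
    define S where "S = (\<Sum>i\<in>UNIV. (B $ i) powr r)"
    have S: "(\<Sum>i\<in>UNIV. (c * B $ i) powr r) = c powr r * S" "S \<ge> 0"
      using c B by (simp_all add: S_def powr_mult sum_distrib_left sum_nonneg)
    have "1 / real CARD('n) * (c powr r * S) = c powr r * (1 / real CARD('n) * S)" by simp
    also have "\<dots> powr (1 / r) = (c powr r) powr (1 / r) * (1 / real CARD('n) * S) powr (1 / r)"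
      by (rule powr_mult)
    also have "(c powr r) powr (1 / r) = c" using c 3 by (simp add: powr_powr)
    finally have mean: "(1 / real CARD('n) * (c powr r * S)) powr (1 / r)
      = c * (1 / real CARD('n) * S) powr (1 / r)" .
    have pos: "(\<forall>i. c * B $ i > 0) \<longleftrightarrow> (\<forall>i. B $ i > 0)"
      using c by (simp add: zero_less_mult_iff)
    show ?thesis
    proof (cases "r < 0 \<and> \<not> (\<forall>i. B $ i > 0)")
      case True
      then show ?thesis using 3 pos by (simp add: holder_mean_def)
    next
      case False
      then have noncrit: "(r < 0 \<and> \<not> (\<forall>i. B $ i > 0)) = False" by blast
      have q0: "(q = -\<infinity>) = False" "(q = 0) = False" "(q < 0) = (r < 0)" "real_of_ereal q = r"
        using 3 by simp_all
      show ?thesis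
        unfolding holder_mean_def vec_lambda_beta q0 pos noncrit if_False S(1) mean S_def[symmetric] ..
    qed
  qed
qed

lemma fluid_policy_horizon_independent:
  assumes P: "admissible P" and q: "q \<le> 1" and T: "T > 0" "T' > 0"
  shows "fluid_policy q P T \<xi> \<longleftrightarrow> fluid_policy q P T' \<xi>"
proof -
  have *: "holder_mean q (fluid_utility P m \<zeta>) = real m * holder_mean q (fluid_utility P 1 \<zeta>)"
    if "m > 0" "static_policy P \<zeta>" for m \<zeta>
  proof -
    have "fluid_utility P m \<zeta> = (\<chi> i. real m * fluid_utility P 1 \<zeta> $ i)"
      by (simp add: fluid_utility_def)
    moreover have "0 \<le> fluid_utility P 1 \<zeta> $ i" for i
    proof -
      have "0 \<le> pmf P \<beta> * \<beta> $ i * \<zeta> \<beta> $ i" if "\<beta> \<in> set_pmf P" for \<beta>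
      proof -
        have "0 \<le> \<beta> $ i" using P that by (simp add: admissible_def)
        moreover have "\<zeta> \<beta> \<in> std_simplex"
          using \<open>static_policy P \<zeta>\<close> that by (simp add: static_policy_def)
        then have "0 \<le> \<zeta> \<beta> $ i" by (simp add: std_simplex_def)
        ultimately show ?thesis by simp
      qed
      then show ?thesis by (simp add: fluid_utility_def sum_nonneg)
    qed
    ultimately show ?thesis
      using holder_mean_scale[of "real m" "fluid_utility P 1 \<zeta>" q] \<open>m > 0\<close> q
      by (simp only: of_nat_0_less_iff)
  qed
  have "fluid_policy q P m \<xi> \<longleftrightarrow> fluid_policy q P 1 \<xi>" if "m > 0" for m
  proof -
    have "holder_mean q (fluid_utility P m \<xi>') \<le> holder_mean q (fluid_utility P m \<xi>) \<longleftrightarrow>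
        holder_mean q (fluid_utility P 1 \<xi>') \<le> holder_mean q (fluid_utility P 1 \<xi>)"
      if "static_policy P \<xi>" "static_policy P \<xi>'" for \<xi>'
      unfolding *[OF \<open>m > 0\<close> that(1)] *[OF \<open>m > 0\<close> that(2)]
      using \<open>m > 0\<close> by (intro mult_le_cancel_left_pos) simp
    then show ?thesis unfolding fluid_policy_def by blast
  qed
  from this[OF T(1)] this[OF T(2)] show ?thesis by blast
qed

end

theory Submission
  imports Defs
begin

text \<open>
  Write \<open>w\<close> for the optimal fluid value with \<open>T = 1\<close> and \<open>N \<beta>\<close> for the number of occurrences of
  \<open>\<beta>\<close>. Averaging the allocations over the periods with the same \<open>b\<^sub>t\<close> shows that hindsight
  allocations may be taken static. If \<open>N \<beta> \<le> c p \<beta>\<close> for all \<open>\<beta>\<close>, then every static utility vector is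
  dominated by \<open>c\<close> times its fluid counterpart, so that monotonicity and homogeneity of the
  Hoelder mean bound the hindsight optimum by \<open>c w\<close>. Dually, \<open>N \<beta> \<ge> c p \<beta>\<close> for all \<open>\<beta>\<close> gives at
  least \<open>c w\<close> for the fluid policy. With \<open>c = T \<plusminus> D\<close>, where
  \<open>D = \<Sum>\<beta>. \<bar>N \<beta> - T p \<beta>\<bar> / p \<beta>\<close>, the pathwise regret is at most \<open>2 w D\<close>, and \<open>D\<close> has expectation
  \<open>O(\<surd>T)\<close> because the counts have variance \<open>O(T)\<close>. No differentiability or concavity of the
  welfare function is involved.
\<close>

section \<open>Hoelder means\<close>

lemma holder_mean_nonneg:
  fixes B :: "real ^ 'n"
  assumes "\<And>i. 0 \<le> B $ i"
  shows "0 \<le> holder_mean q B"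
  using assms by (auto simp: holder_mean_def prod_nonneg)

text \<open>For negative exponents the inner power and the outer power are both antitone on positive
  reals, so their composition is monotone.\<close>

lemma holder_mean_mono:
  fixes B C :: "real ^ 'n"
  assumes B: "\<And>i. 0 \<le> B $ i" and BC: "\<And>i. B $ i \<le> C $ i" and q: "q \<le> 1"
  shows "holder_mean q B \<le> holder_mean q C"
proof -
  have C: "0 \<le> C $ i" for i using B BC order_trans by blast
  consider "q = -\<infinity>" | "q = 0" | r where "q = ereal r" "r > 0" | r where "q = ereal r" "r < 0"
    using q by (cases q) (auto simp: zero_ereal_def, meson linorder_neqE)
  then show ?thesis
  proof cases
    case 1
    have "Min (range (\<lambda>i. B $ i)) \<le> C $ i" for i
      by (rule order_trans[OF Min_le BC]) auto
    then show ?thesis using 1 by (simp add: holder_mean_def)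
  next
    case 2
    then show ?thesis using B BC by (auto simp: holder_mean_def intro!: prod_mono)
  next
    case 3
    have "(\<Sum>i\<in>UNIV. (B $ i) powr r) \<le> (\<Sum>i\<in>UNIV. (C $ i) powr r)"
      using B BC 3 by (intro sum_mono powr_mono2) auto
    then show ?thesis using 3
      by (auto simp: holder_mean_def intro!: powr_mono2 divide_right_mono divide_nonneg_nonneg sum_nonneg)
  next
    case 4
    \<comment> \<open>Since \<open>0 powr r = 0\<close>, the function \<open>powr r\<close> with
      \<open>r < 0\<close> is antitone only on positive arguments. A vector with a zero entry
      therefore needs its own case, where its mean is 0 by convention.\<close>
    show ?thesis
    proof (cases "\<forall>i. B $ i > 0")
      case True
      then have pos: "\<forall>i. C $ i > 0" using BC less_le_trans by blast
      have "(\<Sum>i\<in>UNIV. (C $ i) powr r) \<le> (\<Sum>i\<in>UNIV. (B $ i) powr r)"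
        using True BC 4 by (intro sum_mono powr_mono2') auto
      moreover have "(\<Sum>i\<in>UNIV. (C $ i) powr r) > 0"
        using pos by (intro sum_pos) (auto simp: less_imp_neq[symmetric])
      ultimately show ?thesis using 4 True pos
        by (auto simp: holder_mean_def intro!: powr_mono2' divide_right_mono)
    next
      case False
      then have "holder_mean q B = 0" using 4 by (simp add: holder_mean_def)
      then show ?thesis using holder_mean_nonneg[of C q] C by simp
    qed
  qed
qed

section \<open>Comparison of hindsight, static and fluid utilities\<close>

definition occ :: "nat \<Rightarrow> (nat \<Rightarrow> 'a) \<Rightarrow> 'a \<Rightarrow> real" where
  "occ T b \<beta> = real (card {t \<in> {1..T}. b t = \<beta>})"

lemma cumulative_utility_static:
  fixes \<xi> :: "real ^ 'n \<Rightarrow> real ^ 'n"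
  assumes "finite S" and "b ` {1..T} \<subseteq> S"
  shows "cumulative_utility T b (\<lambda>t. \<xi> (b t)) $ i = (\<Sum>\<beta>\<in>S. occ T b \<beta> * (\<beta> $ i * \<xi> \<beta> $ i))"
proof -
  have "(\<Sum>t\<in>{1..T}. b t $ i * \<xi> (b t) $ i)
      = (\<Sum>\<beta>\<in>S. \<Sum>t\<in>{t \<in> {1..T}. b t = \<beta>}. b t $ i * \<xi> (b t) $ i)"
    using assms by (intro sum.group[symmetric]) auto
  also have "\<dots> = (\<Sum>\<beta>\<in>S. occ T b \<beta> * (\<beta> $ i * \<xi> \<beta> $ i))"
    by (intro sum.cong) (auto simp: occ_def)
  finally show ?thesis by (simp add: cumulative_utility_def)
qed

text \<open>Over the periods with a common value \<beta> the utility is linear in the allocations,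
  so only their sum matters. Replacing each by the average keeps this sum, and the average stays in
  the simplex by convexity.\<close>

lemma cumulative_utility_eq_static:
  fixes P :: "(real ^ 'n) pmf" and x :: "nat \<Rightarrow> real ^ 'n"
  assumes P: "admissible P" and b: "b ` {1..T} \<subseteq> set_pmf P" and x: "x \<in> {1..T} \<rightarrow> std_simplex"
    and F: "static_policy P F"
  obtains \<xi> where "static_policy P \<xi>"
    and "cumulative_utility T b x = cumulative_utility T b (\<lambda>t. \<xi> (b t))"
proof -
  define K where "K \<beta> = {t \<in> {1..T}. b t = \<beta>}" for \<beta>
  have finK[simp]: "finite (K \<beta>)" for \<beta> by (simp add: K_def)
  \<comment> \<open>For support points that never occur, \<open>F\<close> supplies some point of the
    simplex; it contributes nothing because the count is 0.\<close>
  define \<xi> where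
    "\<xi> \<beta> = (if K \<beta> = {} then F \<beta> else (1 / real (card (K \<beta>))) *\<^sub>R (\<Sum>t\<in>K \<beta>. x t))" for \<beta>
  have "\<xi> \<beta> \<in> std_simplex" if "\<beta> \<in> set_pmf P" for \<beta>
  proof (cases "K \<beta> = {}")
    case True
    then show ?thesis using F that by (simp add: \<xi>_def static_policy_def)
  next
    case False
    have xK: "x t \<in> std_simplex" if "t \<in> K \<beta>" for t using x that by (auto simp: K_def)
    have "(\<Sum>i\<in>UNIV. \<Sum>t\<in>K \<beta>. x t $ i) = (\<Sum>t\<in>K \<beta>. \<Sum>i\<in>UNIV. x t $ i)"
      by (rule sum.swap)
    also have "\<dots> = real (card (K \<beta>))" using xK by (simp add: std_simplex_def)
    finally have "(\<Sum>i\<in>UNIV. \<xi> \<beta> $ i) = 1"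
      using False by (simp add: \<xi>_def sum_divide_distrib[symmetric])
    moreover have "0 \<le> \<xi> \<beta> $ i" for i
      using False xK by (auto simp: \<xi>_def std_simplex_def intro!: divide_nonneg_nonneg sum_nonneg)
    ultimately show ?thesis by (simp add: std_simplex_def)
  qed
  then have "static_policy P \<xi>" by (simp add: static_policy_def)
  moreover have "cumulative_utility T b x $ i = cumulative_utility T b (\<lambda>t. \<xi> (b t)) $ i" for i
  proof -
    have fin: "finite (set_pmf P)" using P by (simp add: admissible_def)
    have "(\<Sum>t\<in>{1..T}. b t $ i * x t $ i) = (\<Sum>\<beta>\<in>set_pmf P. \<Sum>t\<in>K \<beta>. b t $ i * x t $ i)"
      unfolding K_def using fin b by (intro sum.group[symmetric]) auto
    also have "\<dots> = (\<Sum>\<beta>\<in>set_pmf P. occ T b \<beta> * (\<beta> $ i * \<xi> \<beta> $ i))"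
    proof (rule sum.cong[OF refl])
      fix \<beta>
      have occK: "occ T b \<beta> = real (card (K \<beta>))" by (simp only: occ_def K_def)
      have "(\<Sum>t\<in>K \<beta>. b t $ i * x t $ i) = \<beta> $ i * (\<Sum>t\<in>K \<beta>. x t $ i)"
        unfolding sum_distrib_left by (rule sum.cong) (auto simp: K_def)
      moreover have "(\<Sum>t\<in>K \<beta>. x t $ i) = occ T b \<beta> * \<xi> \<beta> $ i"
        by (cases "K \<beta> = {}") (simp_all add: occK \<xi>_def)
      ultimately show "(\<Sum>t\<in>K \<beta>. b t $ i * x t $ i) = occ T b \<beta> * (\<beta> $ i * \<xi> \<beta> $ i)"
        by simp
    qed
    finally show ?thesis
      unfolding cumulative_utility_static[OF fin b] by (simp add: cumulative_utility_def)
  qed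
  ultimately show thesis using that by (simp add: vec_eq_iff)
qed

lemma static_utility_nonneg:
  fixes P :: "(real ^ 'n) pmf"
  assumes "admissible P" and "static_policy P \<xi>" and "\<beta> \<in> set_pmf P"
  shows "0 \<le> \<beta> $ i * \<xi> \<beta> $ i"
  using assms by (auto simp: admissible_def static_policy_def std_simplex_def)

lemma fluid_utility_nonneg:
  fixes P :: "(real ^ 'n) pmf"
  assumes "admissible P" and "static_policy P \<xi>"
  shows "0 \<le> fluid_utility P T \<xi> $ i"
  using static_utility_nonneg[OF assms]
  by (auto simp: fluid_utility_def mult.assoc simp del: zero_le_mult_iff intro!: sum_nonneg mult_nonneg_nonneg[OF pmf_nonneg] mult_nonneg_nonneg[OF of_nat_0_le_iff])

lemma cumulative_static_nonneg:
  fixes P :: "(real ^ 'n) pmf"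
  assumes "admissible P" and "static_policy P \<xi>" and "b ` {1..T} \<subseteq> set_pmf P"
  shows "0 \<le> cumulative_utility T b (\<lambda>t. \<xi> (b t)) $ i"
  using static_utility_nonneg[OF assms(1,2)] assms(3)
  by (auto simp: cumulative_utility_def intro!: sum_nonneg)

text \<open>This has the shape of \<open>cumulative_utility_static\<close>, so that comparing the
  two utilities reduces to comparing the coefficients \<open>c * pmf P \<beta>\<close> and
  \<open>occ T b \<beta>\<close>.\<close>

lemma fluid_utility_1_scaled:
  "c * fluid_utility P 1 \<xi> $ i = (\<Sum>\<beta>\<in>set_pmf P. c * pmf P \<beta> * (\<beta> $ i * \<xi> \<beta> $ i))"
  by (simp add: fluid_utility_def sum_distrib_left mult.assoc)

lemma hindsight_welfare_le:
  fixes P :: "(real ^ 'n) pmf"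
  assumes P: "admissible P" and q: "q \<le> 1" and F: "fluid_policy q P 1 F"
    and b: "b ` {1..T} \<subseteq> set_pmf P" and x: "x \<in> {1..T} \<rightarrow> std_simplex"
    and c: "c > 0" "\<And>\<beta>. \<beta> \<in> set_pmf P \<Longrightarrow> occ T b \<beta> \<le> c * pmf P \<beta>"
  shows "holder_mean q (cumulative_utility T b x) \<le> c * holder_mean q (fluid_utility P 1 F)"
proof -
  have fin: "finite (set_pmf P)" using P by (simp add: admissible_def)
  have "static_policy P F" using F by (simp add: fluid_policy_def)
  then obtain \<xi> where \<xi>: "static_policy P \<xi>"
    and eq: "cumulative_utility T b x = cumulative_utility T b (\<lambda>t. \<xi> (b t))"
    using cumulative_utility_eq_static[OF P b x] by blast
  have "holder_mean q (cumulative_utility T b x)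
      \<le> holder_mean q (\<chi> i. c * fluid_utility P 1 \<xi> $ i)"
    unfolding eq
  proof (rule holder_mean_mono[OF cumulative_static_nonneg[OF P \<xi> b] _ q])
    show "cumulative_utility T b (\<lambda>t. \<xi> (b t)) $ i \<le> (\<chi> i. c * fluid_utility P 1 \<xi> $ i) $ i" for i
      unfolding cumulative_utility_static[OF fin b] vec_lambda_beta fluid_utility_1_scaled
      using c(2) static_utility_nonneg[OF P \<xi>] by (intro sum_mono mult_right_mono) auto
  qed
  also have "\<dots> = c * holder_mean q (fluid_utility P 1 \<xi>)"
    by (rule holder_mean_scale[OF c(1) fluid_utility_nonneg[OF P \<xi>] q])
  \<comment> \<open>Here the optimality of \<open>F\<close> enters.\<close>
  also have "\<dots> \<le> c * holder_mean q (fluid_utility P 1 F)"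
    using F \<xi> c by (auto simp: fluid_policy_def intro!: mult_left_mono)
  finally show ?thesis .
qed

text \<open>The sign of \<open>c\<close> is left free because the lemma is applied with
  \<open>T - D\<close>, which is negative when the counts deviate strongly.\<close>

lemma alg_ge:
  fixes P :: "(real ^ 'n) pmf"
  assumes P: "admissible P" and q: "q \<le> 1" and F: "static_policy P F"
    and b: "b ` {1..T} \<subseteq> set_pmf P"
    and c: "\<And>\<beta>. \<beta> \<in> set_pmf P \<Longrightarrow> c * pmf P \<beta> \<le> occ T b \<beta>"
  shows "c * holder_mean q (fluid_utility P 1 F) \<le> alg q T F b"
proof (cases "c > 0")
  case True
  have fin: "finite (set_pmf P)" using P by (simp add: admissible_def)
  have "c * holder_mean q (fluid_utility P 1 F) = holder_mean q (\<chi> i. c * fluid_utility P 1 F $ i)"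
    by (rule holder_mean_scale[OF True fluid_utility_nonneg[OF P F] q, symmetric])
  also have "\<dots> \<le> alg q T F b"
    unfolding alg_def
  proof (rule holder_mean_mono[OF _ _ q])
    show "0 \<le> (\<chi> i. c * fluid_utility P 1 F $ i) $ i" for i
      using True fluid_utility_nonneg[OF P F] by simp
    show "(\<chi> i. c * fluid_utility P 1 F $ i) $ i \<le> cumulative_utility T b (\<lambda>t. F (b t)) $ i" for i
      unfolding cumulative_utility_static[OF fin b] vec_lambda_beta fluid_utility_1_scaled
      using c static_utility_nonneg[OF P F] by (intro sum_mono mult_right_mono) auto
  qed
  finally show ?thesis .
next
  \<comment> \<open>The bound is trivial here: its left side is at most 0 and welfare is
    nonnegative.\<close>
  case False
  then have "c * holder_mean q (fluid_utility P 1 F) \<le> 0"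
    using holder_mean_nonneg[OF fluid_utility_nonneg[OF P F], of q 1]
    by (intro mult_nonpos_nonneg) auto
  also have "0 \<le> alg q T F b"
    unfolding alg_def using cumulative_static_nonneg[OF P F b] by (rule holder_mean_nonneg)
  finally show ?thesis .
qed

section \<open>Pathwise regret bound through weighted count deviations\<close>

text \<open>The weights \<open>1 / pmf P \<beta>\<close> let one number \<open>D\<close> satisfy
  \<open>(T - D) p \<le> N \<le> (T + D) p\<close> at all support points simultaneously.\<close>

definition occ_deviation :: "'a pmf \<Rightarrow> nat \<Rightarrow> (nat \<Rightarrow> 'a) \<Rightarrow> real" where
  "occ_deviation P T b = (\<Sum>\<beta>\<in>set_pmf P. \<bar>occ T b \<beta> - real T * pmf P \<beta>\<bar> / pmf P \<beta>)"

lemma occ_deviation_bound: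
  assumes "finite (set_pmf P)" and \<beta>: "\<beta> \<in> set_pmf P"
  shows "\<bar>occ T b \<beta> - real T * pmf P \<beta>\<bar> \<le> occ_deviation P T b * pmf P \<beta>"
proof -
  have "\<bar>occ T b \<beta> - real T * pmf P \<beta>\<bar> / pmf P \<beta> \<le> occ_deviation P T b"
    unfolding occ_deviation_def using assms
    by (intro member_le_sum[of \<beta> _ "\<lambda>\<beta>. \<bar>occ T b \<beta> - real T * pmf P \<beta>\<bar> / pmf P \<beta>"]) auto
  then show ?thesis using \<beta> by (simp add: pos_divide_le_eq pmf_positive)
qed

lemma pathwise_regret:
  fixes P :: "(real ^ 'n) pmf"
  assumes P: "admissible P" and q: "q \<le> 1" and F: "fluid_policy q P 1 F"
    and b: "b ` {1..T} \<subseteq> set_pmf P" and T: "T > 0"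
  shows "0 \<le> opt q T b - alg q T F b"
    and "opt q T b - alg q T F b
      \<le> 2 * holder_mean q (fluid_utility P 1 F) * occ_deviation P T b"
proof -
  define w where "w = holder_mean q (fluid_utility P 1 F)"
  define D where "D = occ_deviation P T b"
  have D: "D \<ge> 0" by (auto simp: D_def occ_deviation_def intro!: sum_nonneg)
  have fin: "finite (set_pmf P)" using P by (simp add: admissible_def)
  have F': "static_policy P F" using F by (simp add: fluid_policy_def)
  have dev: "\<bar>occ T b \<beta> - real T * pmf P \<beta>\<bar> \<le> D * pmf P \<beta>" if "\<beta> \<in> set_pmf P" for \<beta>
    unfolding D_def using occ_deviation_bound[OF fin that] .
  have upper: "holder_mean q (cumulative_utility T b x) \<le> (real T + D) * w"
    if "x \<in> {1..T} \<rightarrow> std_simplex" for x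
    unfolding w_def using T D dev
    by (intro hindsight_welfare_le[OF P q F b that]) (fastforce simp: algebra_simps abs_le_iff)+
  have lower: "(real T - D) * w \<le> alg q T F b"
    unfolding w_def using dev
    by (intro alg_ge[OF P q F' b]) (fastforce simp: algebra_simps abs_le_iff)
  \<comment> \<open>The allocations of \<open>F\<close> make the index set of the supremum nonempty,
    and \<open>upper\<close> bounds the values above; a real supremum needs both.\<close>
  have FT: "(\<lambda>t. F (b t)) \<in> {1..T} \<rightarrow> std_simplex" using F' b by (auto simp: static_policy_def)
  have "alg q T F b \<le> opt q T b"
    unfolding alg_def opt_def using upper by (intro cSUP_upper[OF FT] bdd_aboveI2)
  then show "0 \<le> opt q T b - alg q T F b" by simp
  have "opt q T b \<le> (real T + D) * w"
    unfolding opt_def using FT upper by (intro cSUP_least) auto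
  with lower show "opt q T b - alg q T F b \<le> 2 * w * D" by (simp add: algebra_simps)
qed

section \<open>Deviation of the counts\<close>

lemma expectation_sum_Pi_pmf:
  fixes f :: "'a \<Rightarrow> real"
  assumes A: "finite A" and P: "finite (set_pmf P)"
  shows "measure_pmf.expectation (Pi_pmf A d (\<lambda>_. P)) (\<lambda>b. \<Sum>t\<in>A. f (b t))
    = real (card A) * measure_pmf.expectation P f"
proof -
  have fin: "finite (set_pmf (Pi_pmf A d (\<lambda>_. P)))"
    using A P by (auto simp: set_Pi_pmf)
  have "measure_pmf.expectation (Pi_pmf A d (\<lambda>_. P)) (\<lambda>b. f (b t)) = measure_pmf.expectation P f"
    if "t \<in> A" for t
  proof -
    have "measure_pmf.expectation (Pi_pmf A d (\<lambda>_. P)) (\<lambda>b. f (b t))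
        = measure_pmf.expectation (map_pmf (\<lambda>b. b t) (Pi_pmf A d (\<lambda>_. P))) f" by simp
    then show ?thesis unfolding Pi_pmf_component[OF A] using that by simp
  qed
  then show ?thesis
    using fin by (subst Bochner_Integration.integral_sum) (auto intro: integrable_measure_pmf_finite)
qed

text \<open>Additivity of variance for independent centred variables: when a draw is added, the
  cross term vanishes because the sum of the earlier draws has mean 0.\<close>

lemma expectation_sum_square_Pi_pmf:
  fixes f :: "'a \<Rightarrow> real"
  assumes A: "finite A" and P: "finite (set_pmf P)" and f: "measure_pmf.expectation P f = 0"
  shows "measure_pmf.expectation (Pi_pmf A d (\<lambda>_. P)) (\<lambda>b. (\<Sum>t\<in>A. f (b t))\<^sup>2)
    = real (card A) * measure_pmf.expectation P (\<lambda>y. (f y)\<^sup>2)"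
  using A
proof (induction A rule: finite_induct)
  case (insert s A)
  define Q where "Q = Pi_pmf A d (\<lambda>_. P)"
  define S where "S b = (\<Sum>t\<in>A. f (b t))" for b
  have finQ: "finite (set_pmf Q)" using insert P by (auto simp: Q_def set_Pi_pmf)
  have S0: "measure_pmf.expectation Q S = 0"
    unfolding S_def Q_def using expectation_sum_Pi_pmf[OF insert(1) P] f by simp
  have int: "integrable (measure_pmf Q) g" for g :: "_ \<Rightarrow> real"
    by (rule integrable_measure_pmf_finite[OF finQ])
  have upd: "(\<Sum>t\<in>insert s A. f ((b(s := y)) t)) = f y + S b" for b y
  proof -
    have "(\<Sum>t\<in>A. f ((b(s := y)) t)) = S b"
      unfolding S_def using insert(2) by (intro sum.cong) auto
    then show ?thesis using insert by simp
  qed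
  \<comment> \<open>Condition on the value \<open>y\<close> of the new coordinate \<open>s\<close>;
    by \<open>upd\<close>, overwriting that coordinate leaves \<open>S\<close> unchanged.\<close>
  have "measure_pmf.expectation (Pi_pmf (insert s A) d (\<lambda>_. P)) (\<lambda>b. (\<Sum>t\<in>insert s A. f (b t))\<^sup>2)
      = (\<Sum>y\<in>set_pmf P. pmf P y * measure_pmf.expectation (map_pmf (\<lambda>b. b(s := y)) Q)
          (\<lambda>b. (\<Sum>t\<in>insert s A. f (b t))\<^sup>2))"
    unfolding Pi_pmf_insert'[OF insert(1,2)] Q_def[symmetric] map_pmf_def[symmetric]
    using P finQ by (subst pmf_expectation_bind[of "set_pmf P"]) auto
  also have "\<dots> = (\<Sum>y\<in>set_pmf P. pmf P y * measure_pmf.expectation Q (\<lambda>b. (f y + S b)\<^sup>2))"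
    unfolding integral_map_pmf upd ..
  also have "\<dots> = (\<Sum>y\<in>set_pmf P. pmf P y * ((f y)\<^sup>2 + measure_pmf.expectation Q (\<lambda>b. (S b)\<^sup>2)))"
  proof (intro sum.cong arg_cong2[where f = "(*)"] refl)
    fix y
    have "measure_pmf.expectation Q (\<lambda>b. (f y + S b)\<^sup>2)
        = measure_pmf.expectation Q (\<lambda>b. ((f y)\<^sup>2 + (S b)\<^sup>2) + 2 * f y * S b)"
      by (simp add: power2_sum)
    also have "\<dots> = (f y)\<^sup>2 + measure_pmf.expectation Q (\<lambda>b. (S b)\<^sup>2)"
      using int S0 by (simp add: measure_pmf.prob_space)
    finally show "measure_pmf.expectation Q (\<lambda>b. (f y + S b)\<^sup>2)
        = (f y)\<^sup>2 + measure_pmf.expectation Q (\<lambda>b. (S b)\<^sup>2)" .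
  qed
  also have "\<dots> = measure_pmf.expectation P (\<lambda>y. (f y)\<^sup>2) + measure_pmf.expectation Q (\<lambda>b. (S b)\<^sup>2)"
    using P sum_pmf_eq_1[OF P, of P]
    by (simp add: integral_measure_pmf_real[OF P] distrib_left sum.distrib
        sum_distrib_right[symmetric] mult.commute)
  finally show ?case using insert by (simp add: S_def Q_def distrib_right)
qed simp

text \<open>A centred count is a sum of \<open>T\<close> independent centred indicators, each
  bounded by 1 in absolute value. Its second moment is thus at most \<open>T\<close>, and its mean
  absolute value at most \<open>sqrt T\<close>.\<close>

lemma expectation_occ_deviation_le:
  assumes P: "finite (set_pmf P)"
  shows "measure_pmf.expectation (Pi_pmf {1..T} d (\<lambda>_. P)) (occ_deviation P T)
    \<le> (\<Sum>\<beta>\<in>set_pmf P. 1 / pmf P \<beta>) * sqrt (real T)"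
proof -
  define Q where "Q = Pi_pmf {1..T} d (\<lambda>_. P)"
  have finQ: "finite (set_pmf Q)" using P by (auto simp: Q_def set_Pi_pmf)
  have int: "integrable (measure_pmf Q) g" for g :: "_ \<Rightarrow> real"
    by (rule integrable_measure_pmf_finite[OF finQ])
  have E: "measure_pmf.expectation Q (\<lambda>b. \<bar>occ T b \<beta> - real T * pmf P \<beta>\<bar>) \<le> sqrt (real T)" for \<beta>
  proof -
    define f where "f y = of_bool (y = \<beta>) - pmf P \<beta>" for y
    have X: "occ T b \<beta> - real T * pmf P \<beta> = (\<Sum>t\<in>{1..T}. f (b t))" for b
      by (simp add: f_def occ_def sum_subtractf of_bool_def sum.If_cases Int_def)
    have "measure_pmf.expectation P (\<lambda>y. of_bool (y = \<beta>) :: real)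
        = measure_pmf.expectation P (indicator {\<beta>})"
      by (rule Bochner_Integration.integral_cong) (auto simp: indicator_def)
    then have f0: "measure_pmf.expectation P f = 0"
      using P by (simp add: f_def[abs_def] integrable_measure_pmf_finite measure_pmf.prob_space
          measure_pmf_single)
    have "\<bar>f y\<bar> \<le> 1" for y using pmf_le_1[of P \<beta>] by (auto simp: f_def)
    then have "(f y)\<^sup>2 \<le> 1" for y by (simp add: abs_square_le_1)
    then have "measure_pmf.expectation P (\<lambda>y. (f y)\<^sup>2) \<le> 1"
      using P by (intro measure_pmf.integral_le_const integrable_measure_pmf_finite) auto
    then have "measure_pmf.expectation Q (\<lambda>b. (occ T b \<beta> - real T * pmf P \<beta>)\<^sup>2) \<le> real T"
      unfolding X Q_def expectation_sum_square_Pi_pmf[OF finite_atLeastAtMost P f0]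
      by (simp add: mult_left_le)
    \<comment> \<open>The square of the mean is at most the mean of the square, because the variance
      of the absolute deviation is nonnegative.\<close>
    moreover have "(measure_pmf.expectation Q (\<lambda>b. \<bar>occ T b \<beta> - real T * pmf P \<beta>\<bar>))\<^sup>2
        \<le> measure_pmf.expectation Q (\<lambda>b. (occ T b \<beta> - real T * pmf P \<beta>)\<^sup>2)"
      using measure_pmf.variance_positive[of Q "\<lambda>b. \<bar>occ T b \<beta> - real T * pmf P \<beta>\<bar>"]
      by (simp add: measure_pmf.variance_eq[OF int int])
    ultimately show ?thesis by (meson order_trans real_le_rsqrt)
  qed
  have "measure_pmf.expectation Q (occ_deviation P T)
      = (\<Sum>\<beta>\<in>set_pmf P. measure_pmf.expectation Q (\<lambda>b. \<bar>occ T b \<beta> - real T * pmf P \<beta>\<bar>) / pmf P \<beta>)"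
    unfolding occ_deviation_def[abs_def] using int by simp
  also have "\<dots> \<le> (\<Sum>\<beta>\<in>set_pmf P. sqrt (real T) / pmf P \<beta>)"
    using E by (intro sum_mono divide_right_mono) auto
  finally show ?thesis by (simp add: Q_def sum_distrib_right)
qed

theorem proposition1:
  fixes P :: "(real ^ 'n) pmf"
    and q :: ereal
    and F :: "real ^ 'n \<Rightarrow> real ^ 'n"
    and T\<^sub>0 :: nat
  assumes "admissible P"
    and "- \<infinity> \<le> q" and "q \<le> 1"
    and "T\<^sub>0 > 0" and "fluid_policy q P T\<^sub>0 F"
  shows "(\<lambda>T. regret q P T F) \<in> O(\<lambda>T. sqrt (real T))"
proof -
  note P = assms(1) and q = assms(3)
  have F: "fluid_policy q P 1 F"
    using fluid_policy_horizon_independent[OF P q assms(4), of 1] assms(5) by simp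
  have fin: "finite (set_pmf P)" using P by (simp add: admissible_def)
  define w where "w = holder_mean q (fluid_utility P 1 F)"
  have w: "w \<ge> 0"
    unfolding w_def using F
    by (intro holder_mean_nonneg fluid_utility_nonneg[OF P]) (simp add: fluid_policy_def)
  define K where "K = (\<Sum>\<beta>\<in>set_pmf P. 1 / pmf P \<beta>)"
  \<comment> \<open>Positivity of \<open>T\<close> makes the factor \<open>T + D\<close> positive in
    the hindsight bound; for the asymptotic claim it suffices to treat such
    \<open>T\<close>.\<close>
  have "norm (regret q P T F) \<le> 2 * w * K * norm (sqrt (real T))" if T: "T > 0" for T
  proof -
    define Q where "Q = Pi_pmf {1..T} 0 (\<lambda>_. P)"
    have finQ: "finite (set_pmf Q)" using fin by (auto simp: Q_def set_Pi_pmf)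
    have int: "integrable (measure_pmf Q) g" for g :: "_ \<Rightarrow> real"
      by (rule integrable_measure_pmf_finite[OF finQ])
    have b: "b ` {1..T} \<subseteq> set_pmf P" if "b \<in> set_pmf Q" for b
      using that by (auto simp: Q_def set_Pi_pmf PiE_dflt_def)
    \<comment> \<open>The O-bound concerns the absolute value, so the lower bound 0 is needed beside
      the upper one.\<close>
    have "0 \<le> regret q P T F"
      unfolding regret_def Q_def[symmetric]
      using pathwise_regret(1)[OF P q F b T] by (intro integral_nonneg_AE) (auto simp: AE_measure_pmf_iff)
    moreover have "regret q P T F
        \<le> measure_pmf.expectation Q (\<lambda>b. 2 * w * occ_deviation P T b)"
      unfolding regret_def Q_def[symmetric] w_def
      using pathwise_regret(2)[OF P q F b T]
      by (intro integral_mono_AE int) (auto simp: AE_measure_pmf_iff)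
    moreover have "\<dots> \<le> 2 * w * (K * sqrt (real T))"
      using expectation_occ_deviation_le[OF fin, of T 0] w
      by (simp add: Q_def K_def mult_left_mono)
    ultimately show ?thesis by (simp add: mult.assoc)
  qed
  then show ?thesis
    by (intro bigoI[where c = "2 * w * K"] eventually_mono[OF eventually_gt_at_top[of 0]]) auto
qed

end
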